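(* Let $\mathscr{M}$ be a $W^*$-algebra, and let $\mathscr{E}$ be a self-dual Hilbert $\mathscr{M}$-module equipped with a conjugation $C$ associated with a $*$-conjugate-automorphism $\sharp$ of $\mathscr{M}$. Write $[x,y]:=\langle Cx,y\rangle$ for $x,y\in\mathscr{E}$. Suppose that $\Gamma:\mathscr{E}\times\mathscr{E}\to\mathscr{M}$ is a bounded form that is bilinear and $\mathscr{M}$-linear in the second variable ($\Gamma(x,ya)=\Gamma(x,y)a$ for all $x,y\in\mathscr{E}$, $a\in\mathscr{M}$), and symmetric ($\Gamma(x,y)^\sharp=\Gamma(y,x)^*$ for all $x,y\in\mathscr{E}$). Then there exists a unique $C$-symmetric operator $T\in\mathbb{L}(\mathscr{E})$ satisfying $$\Gamma(x,y)=[Tx,y],\qquad x,y\in\mathscr{E}.$$ Conversely, every $C$-symmetric operator $T\in\mathbb{L}(\mathscr{E})$ determines a bounded symmetric bilinear form which is $\mathscr{M}$-linear in both variables.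
   Context: A $*$-conjugate-automorphism on a $C^*$-algebra $\mathscr{A}$ is a map $\sharp:\mathscr{A}\to\mathscr{A}$, $a\mapsto a^\sharp$, such that for all $a,b\in\mathscr{A}$, $\lambda\in\mathbb{C}$: (1) $(\lambda a+b)^\sharp=\bar\lambda a^\sharp+b^\sharp$; (2) $(a^\sharp)^\sharp=a$; (3) $(a^\sharp)^*=(a^* )^\sharp$; (4) $(ab)^\sharp=a^\sharp b^\sharp$. Hilbert modules are right modules, with inner products conjugate-linear in the first and linear in the second variable. $\mathbb{L}(\mathscr{E})$ is the $C^*$-algebra of adjointable linear operators on $\mathscr{E}$. A conjugation on $\mathscr{E}$ associated with $\sharp$ (a $\sharp$-conjugation) is a bounded conjugate-linear operator $C:\mathscr{E}\to\mathscr{E}$ with $C^2=I_{\mathscr{E}}$ and $\langle Cx,Cy\rangle=\langle x,y\rangle^\sharp$ for all $x,y\in\mathscr{E}$. An operator $T\in\mathbb{L}(\mathscr{E})$ is $C$-symmetric if $T=CT^*C$. $\mathscr{E}$ is self-dual if every bounded $\mathscr{M}$-linear map $\mathscr{E}\to\mathscr{M}$ has the form $y\mapsto\langle x,y\rangle$ for some $x\in\mathscr{E}$. In the converse, the form that the source attaches to $T$ is $\Gamma_T(x,y):=[T^*x,y]=\langle CT^*x,y\rangle$, and "symmetric" has the same meaning as for $\Gamma$.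
   Formalization: In the converse, M-linearity in the first variable is taken as Γ(xa,y)=(a^♯)^*Γ(x,y); the untwisted rules Γ(xa,y)=Γ(x,y)a or aΓ(x,y) fail, e.g. for M=E=M_2(C), ♯=C=entrywise conjugation, T=I, where the form is x^t y. *)

theory Defs
  imports Complex_Main "HOL-Analysis.Operator_Norm"
begin

class complex_vector = real_vector +
  fixes scaleC :: "complex \<Rightarrow> 'a \<Rightarrow> 'a" (infixr "*\<^sub>C" 75)
  assumes scaleC_add_right: "c *\<^sub>C (x + y) = c *\<^sub>C x + c *\<^sub>C y"
    and scaleC_add_left: "(c + d) *\<^sub>C x = c *\<^sub>C x + d *\<^sub>C x"
    and scaleC_scaleC: "c *\<^sub>C (d *\<^sub>C x) = (c * d) *\<^sub>C x"
    and scaleC_one: "1 *\<^sub>C x = x"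
    and scaleR_scaleC: "r *\<^sub>R x = complex_of_real r *\<^sub>C x"

class complex_normed_vector = complex_vector + real_normed_vector +
  assumes norm_scaleC: "norm (c *\<^sub>C x) = cmod c * norm x"

class complex_banach = complex_normed_vector + banach

instantiation complex :: complex_banach
begin

definition scaleC_complex :: "complex \<Rightarrow> complex \<Rightarrow> complex" where
  "scaleC_complex c z = c * z"

instance
  by standard
    (simp_all add: scaleC_complex_def algebra_simps scaleR_conv_of_real norm_mult)

end

text \<open>No unit is required here: a \<open>W\<^sup>*\<close>-algebra has one automatically, and the class
  \<open>real_normed_algebra_1\<close> would exclude the zero algebra.\<close>

class cstar_algebra = complex_banach + real_normed_algebra +
  fixes star :: "'a \<Rightarrow> 'a"
  assumes scaleC_mult_left: "(c *\<^sub>C a) * b = c *\<^sub>C (a * b)"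
    and scaleC_mult_right: "a * (c *\<^sub>C b) = c *\<^sub>C (a * b)"
    and star_add: "star (a + b) = star a + star b"
    and star_scaleC: "star (c *\<^sub>C a) = cnj c *\<^sub>C star a"
    and star_mult: "star (a * b) = star b * star a"
    and star_star: "star (star a) = a"
    and cstar_identity: "norm (star a * a) = (norm a)\<^sup>2"

definition clinear :: "('a::complex_vector \<Rightarrow> 'b::complex_vector) \<Rightarrow> bool" where
  "clinear f \<longleftrightarrow> linear f \<and> (\<forall>c x. f (c *\<^sub>C x) = c *\<^sub>C f x)"

definition bounded_clinear ::
    "('a::complex_normed_vector \<Rightarrow> 'b::complex_normed_vector) \<Rightarrow> bool" where
  "bounded_clinear f \<longleftrightarrow> bounded_linear f \<and> (\<forall>c x. f (c *\<^sub>C x) = c *\<^sub>C f x)"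

definition bounded_conjugate_linear ::
    "('a::complex_normed_vector \<Rightarrow> 'b::complex_normed_vector) \<Rightarrow> bool" where
  "bounded_conjugate_linear f \<longleftrightarrow>
     bounded_linear f \<and> (\<forall>c x. f (c *\<^sub>C x) = cnj c *\<^sub>C f x)"

definition bounded_cbilinear ::
    "('a::complex_normed_vector \<Rightarrow> 'b::complex_normed_vector \<Rightarrow> 'c::complex_normed_vector)
      \<Rightarrow> bool" where
  "bounded_cbilinear B \<longleftrightarrow> bounded_bilinear B \<and>
     (\<forall>c x y. B (c *\<^sub>C x) y = c *\<^sub>C B x y) \<and>
     (\<forall>c x y. B x (c *\<^sub>C y) = c *\<^sub>C B x y)"

text \<open>A \<open>W\<^sup>*\<close>-algebra is a \<open>C\<^sup>*\<close>-algebra that is, as a Banach space, the dual of a Banach space.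
  Here \<open>J\<close> is an isometric isomorphism of the algebra onto the dual of the type \<open>'p\<close>.  HOL cannot
  quantify existentially over the type \<open>'p\<close>; a hypothesis \<open>wstar_algebra J\<close> with \<open>J\<close> and \<open>'p\<close>
  arbitrary says that some predual exists.\<close>

definition wstar_algebra ::
    "('m::cstar_algebra \<Rightarrow> 'p::complex_banach \<Rightarrow> complex) \<Rightarrow> bool" where
  "wstar_algebra J \<longleftrightarrow>
     (\<forall>a. bounded_clinear (J a)) \<and>
     (\<forall>a b p. J (a + b) p = J a p + J b p) \<and>
     (\<forall>c a p. J (c *\<^sub>C a) p = c * J a p) \<and>
     (\<forall>a. onorm (J a) = norm a) \<and>
     (\<forall>f. bounded_clinear f \<longrightarrow> (\<exists>a. J a = f))"

definition star_conj_automorphism :: "('m::cstar_algebra \<Rightarrow> 'm) \<Rightarrow> bool" where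
  "star_conj_automorphism sharp \<longleftrightarrow>
     (\<forall>c a b. sharp (c *\<^sub>C a + b) = cnj c *\<^sub>C sharp a + sharp b) \<and>
     (\<forall>a. sharp (sharp a) = a) \<and>
     (\<forall>a. star (sharp a) = sharp (star a)) \<and>
     (\<forall>a b. sharp (a * b) = sharp a * sharp b)"

text \<open>The norm of the type \<open>'e\<close> is required to be the Hilbert module norm, so completeness is
  the one provided by the class.\<close>

locale hilbert_module =
  fixes act :: "'e::complex_banach \<Rightarrow> 'm::cstar_algebra \<Rightarrow> 'e"
    and ip :: "'e \<Rightarrow> 'e \<Rightarrow> 'm"
  assumes act_add_left: "act (x + y) a = act x a + act y a"
    and act_add_right: "act x (a + b) = act x a + act x b"
    and act_mult: "act x (a * b) = act (act x a) b"
    and act_scaleC_left: "act (c *\<^sub>C x) a = c *\<^sub>C act x a"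
    and act_scaleC_right: "act x (c *\<^sub>C a) = c *\<^sub>C act x a"
    and ip_add_right: "ip x (y + z) = ip x y + ip x z"
    and ip_scaleC_right: "ip x (c *\<^sub>C y) = c *\<^sub>C ip x y"
    and ip_act_right: "ip x (act y a) = ip x y * a"
    and ip_star: "star (ip x y) = ip y x"
    and ip_positive: "\<exists>b. ip x x = star b * b"
    and ip_definite: "ip x x = 0 \<Longrightarrow> x = 0"
    and norm_ip: "norm x = sqrt (norm (ip x x))"

definition self_dual ::
    "('e::complex_banach \<Rightarrow> 'm::cstar_algebra \<Rightarrow> 'e) \<Rightarrow> ('e \<Rightarrow> 'e \<Rightarrow> 'm) \<Rightarrow> bool" where
  "self_dual act ip \<longleftrightarrow>
     (\<forall>f. bounded_clinear f \<and> (\<forall>y a. f (act y a) = f y * a) \<longrightarrow>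
          (\<exists>x. \<forall>y. f y = ip x y))"

definition is_adjoint ::
    "('e \<Rightarrow> 'e \<Rightarrow> 'm) \<Rightarrow> ('e \<Rightarrow> 'e) \<Rightarrow> ('e \<Rightarrow> 'e) \<Rightarrow> bool" where
  "is_adjoint ip T S \<longleftrightarrow> (\<forall>x y. ip (T x) y = ip x (S y))"

definition adjointable :: "('e::complex_banach \<Rightarrow> 'e \<Rightarrow> 'm) \<Rightarrow> ('e \<Rightarrow> 'e) set" where
  "adjointable ip = {T. clinear T \<and> (\<exists>S. is_adjoint ip T S)}"

definition adjoint_op :: "('e \<Rightarrow> 'e \<Rightarrow> 'm) \<Rightarrow> ('e \<Rightarrow> 'e) \<Rightarrow> ('e \<Rightarrow> 'e)" where
  "adjoint_op ip T = (THE S. is_adjoint ip T S)"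

definition sharp_conjugation ::
    "('e::complex_banach \<Rightarrow> 'e \<Rightarrow> 'm) \<Rightarrow> ('m \<Rightarrow> 'm) \<Rightarrow> ('e \<Rightarrow> 'e) \<Rightarrow> bool" where
  "sharp_conjugation ip sharp C \<longleftrightarrow>
     bounded_conjugate_linear C \<and> C \<circ> C = id \<and>
     (\<forall>x y. ip (C x) (C y) = sharp (ip x y))"

definition conj_form :: "('e \<Rightarrow> 'e \<Rightarrow> 'm) \<Rightarrow> ('e \<Rightarrow> 'e) \<Rightarrow> 'e \<Rightarrow> 'e \<Rightarrow> 'm" where
  "conj_form ip C x y = ip (C x) y"

definition C_symmetric ::
    "('e \<Rightarrow> 'e \<Rightarrow> 'm) \<Rightarrow> ('e \<Rightarrow> 'e) \<Rightarrow> ('e \<Rightarrow> 'e) \<Rightarrow> bool" where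
  "C_symmetric ip C T \<longleftrightarrow> T = C \<circ> adjoint_op ip T \<circ> C"

definition symmetric_form :: "('m::cstar_algebra \<Rightarrow> 'm) \<Rightarrow> ('e \<Rightarrow> 'e \<Rightarrow> 'm) \<Rightarrow> bool" where
  "symmetric_form sharp G \<longleftrightarrow> (\<forall>x y. sharp (G x y) = star (G y x))"

definition module_linear_snd ::
    "('e \<Rightarrow> 'm::cstar_algebra \<Rightarrow> 'e) \<Rightarrow> ('e \<Rightarrow> 'e \<Rightarrow> 'm) \<Rightarrow> bool" where
  "module_linear_snd act G \<longleftrightarrow> (\<forall>x y a. G x (act y a) = G x y * a)"

text \<open>In the first variable \<open>\<M>\<close>-linearity is relative to the linear anti-automorphism
  \<open>a \<mapsto> (a\<^sup>\<sharp>)\<^sup>*\<close>: since \<open>C (x a) = (C x) a\<^sup>\<sharp>\<close>, one has \<open>[x a, y] = (a\<^sup>\<sharp>)\<^sup>* [x, y]\<close>.  For a commutative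
  algebra with \<open>\<sharp>\<close> the involution this is \<open>[x a, y] = [x, y] a\<close>; the untwisted rules fail for
  \<open>[\<cdot>, \<cdot>]\<close> itself over a matrix algebra.\<close>

definition module_linear_fst ::
    "('e \<Rightarrow> 'm::cstar_algebra \<Rightarrow> 'e) \<Rightarrow> ('m \<Rightarrow> 'm) \<Rightarrow> ('e \<Rightarrow> 'e \<Rightarrow> 'm) \<Rightarrow> bool" where
  "module_linear_fst act sharp G \<longleftrightarrow> (\<forall>x y a. G (act x a) y = star (sharp a) * G x y)"

end

theory Submission
  imports Defs "HOL-Analysis.Urysohn"
begin

text \<open>Self-duality represents each functional \<open>\<Gamma>(x, \<cdot>)\<close> by a vector \<open>R x\<close>, and \<open>T = C \<circ> R\<close> is the
  required operator. Moving \<open>C\<close> across the inner product, the symmetry of \<open>\<Gamma>\<close> becomes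
  \<open>\<langle>T x, y\<rangle> = \<langle>x, C T C y\<rangle>\<close>, so that \<open>T\<close> has the adjoint \<open>C T C\<close>. In the converse, only the
  boundedness of the form needs an argument: an adjointable operator is bounded by the uniform
  boundedness principle.\<close>

section \<open>Uniform boundedness principle\<close>

text \<open>Baire category argument: the closed sets on which the whole family is bounded by an
  integer cover the Banach space, so one of them contains a ball, and linearity carries the bound
  from that ball to every vector.\<close>

theorem uniform_boundedness:
  fixes f :: "'i \<Rightarrow> 'a::banach \<Rightarrow> 'b::real_normed_vector"
  assumes lin: "\<And>i. i \<in> I \<Longrightarrow> bounded_linear (f i)"
    and pointwise: "\<And>x. \<exists>K. \<forall>i\<in>I. norm (f i x) \<le> K"
  shows "\<exists>K. \<forall>i\<in>I. \<forall>x. norm (f i x) \<le> K * norm x"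
proof -
  define F where "F n = {x. \<forall>i\<in>I. norm (f i x) \<le> real n}" for n
  have closed_F: "closed (F n)" for n
  proof -
    have "closed {x. norm (f i x) \<le> real n}" if "i \<in> I" for i
      using bounded_linear.continuous_on[OF lin[OF that] continuous_on_id]
      by (intro closed_Collect_le continuous_on_norm continuous_on_const)
    moreover have "F n = (\<Inter>i\<in>I. {x. norm (f i x) \<le> real n})"
      unfolding F_def by auto
    ultimately show ?thesis by auto
  qed
  have cover: "(\<Union>n. F n) = UNIV"
  proof -
    have "\<exists>n. x \<in> F n" for x
    proof -
      obtain K where "\<forall>i\<in>I. norm (f i x) \<le> K"
        using pointwise by blast
      moreover obtain n where "K \<le> real n"
        using real_arch_simple by blast
      ultimately show ?thesis
        unfolding F_def by (auto intro: order_trans)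
    qed
    then show ?thesis by auto
  qed
  \<comment> \<open>If every \<open>F n\<close> had empty interior, Baire would give their countable
    union empty interior, yet that union is the whole space.\<close>
  have "\<exists>n. interior (F n) \<noteq> {}"
  proof (rule ccontr)
    assume "\<not> ?thesis"
    then have "euclidean interior_of \<Union>(range F) = {}"
      using closed_F
      by (intro Baire_category_alt) (auto simp: completely_metrizable_space_euclidean)
    then show False
      using cover by simp
  qed
  then obtain n a e where e: "e > 0" and sub: "cball a e \<subseteq> F n"
    unfolding mem_interior_cball ex_in_conv[symmetric] by blast
  have "norm (f i x) \<le> (2 * real n / e) * norm x" if i: "i \<in> I" for i x
  proof (cases "x = 0")
    case True
    then show ?thesis
      using linear_0[OF bounded_linear.linear[OF lin[OF i]]] by simp
  next
    case False
    interpret bounded_linear "f i"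
      by (rule lin[OF i])
    \<comment> \<open>Rescaling \<open>x\<close> to length \<open>e\<close> keeps
      \<open>a + u\<close> in the ball. Both \<open>f i (a + u)\<close> and \<open>f i a\<close> are
      then bounded by \<open>n\<close>, which is where the constant \<open>2 * n / e\<close> comes
      from.\<close>
    define u where "u = (e / norm x) *\<^sub>R x"
    have "a + u \<in> F n" "a \<in> F n"
      using e False by (auto simp: u_def dist_norm intro!: subsetD[OF sub])
    then have "norm (f i (a + u)) \<le> real n" "norm (f i a) \<le> real n"
      using i unfolding F_def by auto
    moreover have "f i u = f i (a + u) - f i a"
      by (simp add: add)
    ultimately have "norm (f i u) \<le> 2 * real n"
      using norm_triangle_ineq4[of "f i (a + u)" "f i a"] by simp
    moreover have "norm (f i u) = e / norm x * norm (f i x)"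
      using e by (simp add: u_def scaleR)
    ultimately show ?thesis
      using e False by (simp add: field_simps)
  qed
  then show ?thesis by blast
qed

section \<open>Complex scalars and the inner product: polarization bound and cancellation\<close>

lemma scaleC_minus_left: "(- c) *\<^sub>C x = - (c *\<^sub>C (x::'a::complex_vector))"
proof -
  have "0 *\<^sub>C x = 0"
    using scaleR_scaleC[of 0 x] by simp
  then show ?thesis
    using scaleC_add_left[of "- c" c x] by (simp add: eq_neg_iff_add_eq_0)
qed

lemma scaleC_diff_right: "c *\<^sub>C (x - y) = c *\<^sub>C x - c *\<^sub>C (y::'a::complex_vector)"
  using scaleC_add_right[of c "x - y" y] by (simp add: algebra_simps)

context hilbert_module
begin

lemma ip_add_left: "ip (x + y) z = ip x z + ip y z"
  by (metis ip_add_right ip_star star_add)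

lemma ip_scaleC_left: "ip (c *\<^sub>C x) y = cnj c *\<^sub>C ip x y"
  by (metis ip_scaleC_right ip_star star_scaleC)

lemma ip_act_left: "ip (act x a) y = star a * ip x y"
  by (metis ip_act_right ip_star star_mult)

lemma norm_ip_self: "norm (ip x x) = (norm x)\<^sup>2"
  by (simp add: norm_ip)

text \<open>A crude substitute for the Cauchy--Schwarz inequality, by polarization; it avoids the order
  on the algebra.\<close>

lemma norm_ip_le_unit:
  assumes x: "norm x \<le> 1" and y: "norm y \<le> 1"
  shows "norm (ip x y) \<le> 6"
proof -
  have bound: "norm (c *\<^sub>C ip x y + cnj c *\<^sub>C ip y x) \<le> 6" if c: "cmod c = 1" for c
  proof -
    let ?z = "x + c *\<^sub>C y"
    \<comment> \<open>A unimodular \<open>c\<close> leaves \<open>ip y y\<close> unchanged in the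
      expansion of \<open>ip ?z ?z\<close>, so subtracting the diagonal terms isolates the cross
      terms. The bound 6 is 4 + 1 + 1.\<close>
    have "c *\<^sub>C cnj c *\<^sub>C ip y y = ip y y"
      using c complex_norm_square[of c] by (simp add: scaleC_scaleC scaleC_one)
    then have eq: "c *\<^sub>C ip x y + cnj c *\<^sub>C ip y x = ip ?z ?z - ip x x - ip y y"
      by (simp add: ip_add_left ip_add_right ip_scaleC_left ip_scaleC_right scaleC_add_right)
    have "norm ?z \<le> 2"
      using norm_triangle_ineq[of x "c *\<^sub>C y"] x y c by (simp add: norm_scaleC)
    then have "norm (ip ?z ?z) \<le> 4"
      using power_mono[of "norm ?z" 2 2] by (simp add: norm_ip_self)
    moreover have "norm (ip x x) \<le> 1" "norm (ip y y) \<le> 1"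
      using x y by (simp_all add: norm_ip_self power_le_one)
    moreover have "norm (ip ?z ?z - ip x x - ip y y) \<le> norm (ip ?z ?z) + norm (ip x x) + norm (ip y y)"
      using norm_triangle_ineq4[of "ip ?z ?z - ip x x" "ip y y"]
        norm_triangle_ineq4[of "ip ?z ?z" "ip x x"] by linarith
    ultimately show ?thesis
      unfolding eq by linarith
  qed
  have plus: "norm (ip x y + ip y x) \<le> 6"
    using bound[of 1] by (simp add: scaleC_one)
  \<comment> \<open>The choice \<open>c = 1\<close> bounded the sum of \<open>ip x y\<close> and
    \<open>ip y x\<close>; \<open>c = \<i>\<close> bounds their difference, and averaging the two
    recovers \<open>ip x y\<close> with the same constant.\<close>
  have "\<i> *\<^sub>C ip x y + cnj \<i> *\<^sub>C ip y x = \<i> *\<^sub>C (ip x y - ip y x)"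
    by (simp add: scaleC_minus_left scaleC_diff_right)
  then have minus: "norm (ip x y - ip y x) \<le> 6"
    using bound[of \<i>] by (simp add: norm_scaleC)
  have "2 *\<^sub>R ip x y = (ip x y + ip y x) + (ip x y - ip y x)"
    by (simp add: scaleR_2)
  then have "2 * norm (ip x y) \<le> norm (ip x y + ip y x) + norm (ip x y - ip y x)"
    using norm_triangle_ineq[of "ip x y + ip y x" "ip x y - ip y x"]
    by (metis abs_numeral norm_scaleR)
  then show ?thesis
    using plus minus by linarith
qed

lemma ip_scaleR_left: "ip (r *\<^sub>R x) y = r *\<^sub>R ip x y"
  by (simp add: scaleR_scaleC ip_scaleC_left)

lemma ip_scaleR_right: "ip x (r *\<^sub>R y) = r *\<^sub>R ip x y"
  by (simp add: scaleR_scaleC ip_scaleC_right)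

lemma ip_zero_left: "ip 0 y = 0"
  using ip_scaleR_left[of 0 0 y] by simp

lemma ip_zero_right: "ip x 0 = 0"
  using ip_scaleR_right[of x 0 0] by simp

lemma bounded_bilinear_ip: "bounded_bilinear ip"
proof
  show "\<exists>K. \<forall>x y. norm (ip x y) \<le> norm x * norm y * K"
  proof (intro exI allI)
    fix x y
    show "norm (ip x y) \<le> norm x * norm y * 6"
    proof (cases "x = 0 \<or> y = 0")
      case True
      then show ?thesis by (auto simp: ip_zero_left ip_zero_right)
    next
      case False
      have "norm (ip (x /\<^sub>R norm x) (y /\<^sub>R norm y)) \<le> 6"
        using False by (intro norm_ip_le_unit) simp_all
      then show ?thesis
        using False by (simp add: ip_scaleR_left ip_scaleR_right field_simps)
    qed
  qed
qed (simp_all add: ip_add_left ip_add_right ip_scaleR_left ip_scaleR_right)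

lemma ip_diff_left: "ip (x - y) z = ip x z - ip y z"
  by (rule bounded_bilinear.diff_left[OF bounded_bilinear_ip])

text \<open>Nondegeneracy, from definiteness at \<open>z = x - y\<close>. It yields uniqueness of
  adjoints and of representing vectors.\<close>

lemma ip_left_cancel: "(\<And>z. ip x z = ip y z) \<Longrightarrow> x = y"
  using ip_definite[of "x - y"] by (simp add: ip_diff_left)

lemma ip_right_cancel: "(\<And>z. ip z x = ip z y) \<Longrightarrow> x = y"
  by (metis ip_left_cancel ip_star)

section \<open>Adjoints and their boundedness\<close>

lemma is_adjoint_commute: "is_adjoint ip T S \<longleftrightarrow> is_adjoint ip S T"
  unfolding is_adjoint_def by (metis ip_star)

text \<open>Cancellation makes adjoints unique, so the definite description in
  \<open>adjoint_op\<close> denotes any adjoint that has been exhibited.\<close>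

lemma adjoint_op_eqI: "is_adjoint ip T S \<Longrightarrow> adjoint_op ip T = S"
  unfolding adjoint_op_def is_adjoint_def
  by (rule the_equality) (auto intro!: ip_right_cancel)

lemma is_adjoint_adjoint_op: "T \<in> adjointable ip \<Longrightarrow> is_adjoint ip T (adjoint_op ip T)"
  using adjoint_op_eqI unfolding adjointable_def by blast

text \<open>Uniform boundedness is applied to the maps \<open>ip (?S y)\<close> with
  \<open>y\<close> in the unit ball: they are pointwise bounded because
  \<open>ip (?S y) x = ip y (T x)\<close>. Testing the uniform bound on the normalized vector
  \<open>T x\<close> then bounds \<open>T\<close>.\<close>

lemma adjointable_bounded_linear:
  assumes T: "T \<in> adjointable ip"
  shows "bounded_linear T"
proof -
  let ?S = "adjoint_op ip T"
  have adj: "ip (?S y) x = ip y (T x)" for x y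
    using is_adjoint_adjoint_op[OF T] is_adjoint_commute unfolding is_adjoint_def by blast
  interpret ip: bounded_bilinear ip
    by (rule bounded_bilinear_ip)
  obtain B where B: "\<And>x y. norm (ip x y) \<le> norm x * norm y * B" "B \<ge> 0"
    using ip.nonneg_bounded by blast
  have "\<exists>K. \<forall>y\<in>cball 0 1. \<forall>x. norm (ip (?S y) x) \<le> K * norm x"
  proof (rule uniform_boundedness)
    show "bounded_linear (ip (?S y))" for y
      by (rule ip.bounded_linear_right)
    fix x
    have "norm (ip (?S y) x) \<le> norm (T x) * B" if "y \<in> cball 0 1" for y
    proof -
      have "norm y * (norm (T x) * B) \<le> 1 * (norm (T x) * B)"
        using that B(2) by (intro mult_right_mono) auto
      then show ?thesis
        using B(1)[of y "T x"] by (simp add: adj mult.assoc)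
    qed
    then show "\<exists>K. \<forall>y\<in>cball 0 1. norm (ip (?S y) x) \<le> K"
      by blast
  qed
  then obtain K where K: "\<And>x y. norm y \<le> 1 \<Longrightarrow> norm (ip y (T x)) \<le> K * norm x"
    unfolding adj by (metis mem_cball_0)
  have "norm (T x) \<le> norm x * K" for x
  proof (cases "T x = 0")
    \<comment> \<open>The sign of \<open>K\<close> is not known in advance; \<open>y = 0\<close> in
      the uniform bound gives \<open>0 \<le> K * norm x\<close>.\<close>
    case True
    then show ?thesis
      using K[of 0 x] by (simp add: ip_zero_left mult.commute)
  next
    case False
    have "norm (ip (T x /\<^sub>R norm (T x)) (T x)) = norm (T x)"
      using False by (simp add: ip_scaleR_left norm_ip_self power2_eq_square)
    then show ?thesis
      using K[of "T x /\<^sub>R norm (T x)" x] False by (simp add: mult.commute)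
  qed
  moreover have "linear T"
    using T unfolding adjointable_def clinear_def by blast
  ultimately show ?thesis
    unfolding bounded_linear_def bounded_linear_axioms_def by blast
qed

section \<open>Conjugations and the representation of symmetric forms\<close>

text \<open>Write \<open>y\<close> as \<open>C (C y)\<close> and apply the defining identity of the
  conjugation.\<close>

lemma sharp_conjugation_ip_swap:
  assumes "sharp_conjugation ip sharp C"
  shows "ip (C x) y = sharp (ip x (C y))"
  using assms unfolding sharp_conjugation_def by (metis comp_apply id_apply)

theorem symmetric_form_represented:
  assumes sd: "self_dual act ip"
    and conj: "sharp_conjugation ip sharp C"
    and bil: "bounded_cbilinear G" and lin: "module_linear_snd act G"
    and sym: "symmetric_form sharp G"
  shows "\<exists>!T. T \<in> adjointable ip \<and> C_symmetric ip C T \<and> (\<forall>x y. G x y = conj_form ip C (T x) y)"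
proof -
  have C_lin: "bounded_linear C" and C_scale: "\<And>c x. C (c *\<^sub>C x) = cnj c *\<^sub>C C x"
    and CC: "\<And>x. C (C x) = x"
    using conj unfolding sharp_conjugation_def bounded_conjugate_linear_def
    by (auto simp: fun_eq_iff)
  have G_bil: "bounded_bilinear G" and G_scale1: "\<And>c x y. G (c *\<^sub>C x) y = c *\<^sub>C G x y"
    and G_scale2: "\<And>c x y. G x (c *\<^sub>C y) = c *\<^sub>C G x y"
    using bil unfolding bounded_cbilinear_def by auto
  have "\<exists>z. \<forall>y. G x y = ip z y" for x
    using sd lin bounded_bilinear.bounded_linear_right[OF G_bil] G_scale2
    unfolding self_dual_def bounded_clinear_def module_linear_snd_def by blast
  then obtain R where R: "\<And>x y. G x y = ip (R x) y"
    by metis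
  define T where "T = (\<lambda>x. C (R x))"
  have rep: "G x y = ip (C (T x)) y" for x y
    by (simp add: T_def CC R)
  have R_add: "R (x + y) = R x + R y" for x y
    by (rule ip_left_cancel) (simp add: ip_add_left bounded_bilinear.add_left[OF G_bil] flip: R)
  \<comment> \<open>\<open>R\<close> is conjugate-linear because \<open>G\<close> is linear and
    \<open>ip\<close> conjugate-linear in the first variable; composing with the conjugate-linear
    \<open>C\<close> makes \<open>T\<close> linear.\<close>
  have R_scale: "R (c *\<^sub>C x) = cnj c *\<^sub>C R x" for c x
    by (rule ip_left_cancel) (simp add: ip_scaleC_left G_scale1 flip: R)
  have T_scale: "T (c *\<^sub>C x) = c *\<^sub>C T x" for c x
    by (simp add: T_def R_scale C_scale)
  have "linear T"
    by (rule linearI)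
      (simp_all add: T_def R_add linear_add[OF bounded_linear.linear[OF C_lin]]
        scaleR_scaleC R_scale C_scale)
  then have T_lin: "clinear T"
    using T_scale by (simp add: clinear_def)
  have adj: "is_adjoint ip T (C \<circ> T \<circ> C)"
    unfolding is_adjoint_def
  proof (intro allI)
    fix x y
    have "ip (T x) y = sharp (ip (C (T x)) (C y))"
      using sharp_conjugation_ip_swap[OF conj, of "C (T x)" y] by (simp add: CC)
    also have "\<dots> = star (G (C y) x)"
      using sym by (simp add: symmetric_form_def flip: rep)
    also have "\<dots> = ip x ((C \<circ> T \<circ> C) y)"
      by (simp add: rep ip_star)
    finally show "ip (T x) y = ip x ((C \<circ> T \<circ> C) y)" .
  qed
  \<comment> \<open>The adjoint is \<open>C \<circ> T \<circ> C\<close>, and conjugating it by the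
    involution \<open>C\<close> returns \<open>T\<close>.\<close>
  have "C_symmetric ip C T"
    unfolding C_symmetric_def adjoint_op_eqI[OF adj] by (simp add: fun_eq_iff CC)
  moreover have "T \<in> adjointable ip"
    using T_lin adj unfolding adjointable_def by blast
  moreover have "T' = T" if T': "\<forall>x y. G x y = conj_form ip C (T' x) y" for T'
  proof
    fix x
    have "C (T' x) = C (T x)"
      by (rule ip_left_cancel) (use T' in \<open>simp add: conj_form_def flip: rep\<close>)
    then show "T' x = T x"
      by (metis CC)
  qed
  moreover have "\<forall>x y. G x y = conj_form ip C (T x) y"
    by (simp add: conj_form_def flip: rep)
  ultimately show ?thesis
    by blast
qed

section \<open>Forms defined by C-symmetric operators\<close>

text \<open>C-symmetry intertwines \<open>T\<close> with its adjoint through \<open>C\<close>, which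
  gives \<open>G x y\<close> the two further expressions \<open>ip (T (C x)) y\<close> and
  \<open>ip (C x) (?S y)\<close>. Each property is read off from a suitable expression.\<close>

theorem C_symmetric_form:
  assumes aut: "star_conj_automorphism sharp"
    and conj: "sharp_conjugation ip sharp C"
    and T: "T \<in> adjointable ip" and T_sym: "C_symmetric ip C T"
  defines "G \<equiv> \<lambda>x y. conj_form ip C (adjoint_op ip T x) y"
  shows "bounded_cbilinear G" "symmetric_form sharp G"
    "module_linear_fst act sharp G" "module_linear_snd act G"
proof -
  let ?S = "adjoint_op ip T"
  have C_lin: "bounded_linear C" and C_scale: "\<And>c x. C (c *\<^sub>C x) = cnj c *\<^sub>C C x"
    and CC: "\<And>x. C (C x) = x"
    using conj unfolding sharp_conjugation_def bounded_conjugate_linear_def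
    by (auto simp: fun_eq_iff)
  have sharp_mult: "sharp (a * b) = sharp a * sharp b" and sharp_sharp: "sharp (sharp a) = a"
    and star_sharp: "star (sharp a) = sharp (star a)" for a b
    using aut unfolding star_conj_automorphism_def by auto
  have adj: "ip (T x) y = ip x (?S y)" "ip (?S x) y = ip x (T y)" for x y
    using is_adjoint_adjoint_op[OF T] is_adjoint_commute unfolding is_adjoint_def by blast+
  have swap: "ip (C x) y = sharp (ip x (C y))" for x y
    by (rule sharp_conjugation_ip_swap[OF conj])
  \<comment> \<open>C-symmetry is evaluated at \<open>C x\<close>, where the inner \<open>C\<close>
    cancels.\<close>
  have TC: "T (C x) = C (?S x)" for x
    using fun_cong[OF T_sym[unfolded C_symmetric_def], of "C x"] by (simp add: CC)
  have G: "G x y = ip (T (C x)) y" for x y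
    by (simp add: G_def conj_form_def TC)
  have G': "G x y = ip (C x) (?S y)" for x y
    by (simp add: G adj)
  have "bounded_linear (\<lambda>x. T (C x))"
    using adjointable_bounded_linear[OF T] C_lin by (rule bounded_linear_compose)
  then have "bounded_bilinear (\<lambda>x y. ip (T (C x)) y)"
    by (rule bounded_bilinear.comp1[OF bounded_bilinear_ip])
  then have "bounded_bilinear G"
    by (simp flip: G)
  moreover have "G (c *\<^sub>C x) y = c *\<^sub>C G x y" for c x y
    by (simp add: G' C_scale ip_scaleC_left)
  moreover have "G x (c *\<^sub>C y) = c *\<^sub>C G x y" for c x y
    by (simp add: G ip_scaleC_right)
  ultimately show "bounded_cbilinear G"
    unfolding bounded_cbilinear_def by blast
  show "symmetric_form sharp G"
    unfolding symmetric_form_def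
  proof (intro allI)
    fix x y
    \<comment> \<open>Moving \<open>C\<close> to the other side produces a second
      \<open>sharp\<close>, which cancels the first; the adjoint relation then turns the result into
      \<open>ip x (T (C y))\<close>, the star of \<open>G y x\<close>.\<close>
    have "sharp (G x y) = ip (?S x) (C y)"
      by (simp add: G TC swap sharp_sharp)
    also have "\<dots> = star (G y x)"
      by (simp add: G adj ip_star)
    finally show "sharp (G x y) = star (G y x)" .
  qed
  \<comment> \<open>By \<open>swap\<close>, the factor \<open>star a\<close> that leaves the first
    slot of \<open>ip\<close> lies under \<open>sharp\<close>; multiplicativity of
    \<open>sharp\<close> and its commutation with \<open>star\<close> turn it into the left factor
    \<open>star (sharp a)\<close>.\<close>
  show "module_linear_fst act sharp G"
    by (simp add: module_linear_fst_def G' swap ip_act_left sharp_mult star_sharp)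
  show "module_linear_snd act G"
    by (simp add: module_linear_snd_def G ip_act_right)
qed

end

theorem theorem4p7:
  fixes J :: "'m::cstar_algebra \<Rightarrow> 'p::complex_banach \<Rightarrow> complex"
    and sharp :: "'m \<Rightarrow> 'm"
    and act :: "'e::complex_banach \<Rightarrow> 'm \<Rightarrow> 'e"
    and ip :: "'e \<Rightarrow> 'e \<Rightarrow> 'm"
    and C :: "'e \<Rightarrow> 'e"
  assumes "wstar_algebra J"
    and "star_conj_automorphism sharp"
    and "hilbert_module act ip"
    and "self_dual act ip"
    and "sharp_conjugation ip sharp C"
  shows "(\<forall>\<Gamma>. bounded_cbilinear \<Gamma> \<and> module_linear_snd act \<Gamma> \<and> symmetric_form sharp \<Gamma> \<longrightarrow>
            (\<exists>!T. T \<in> adjointable ip \<and> C_symmetric ip C T \<and>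
                  (\<forall>x y. \<Gamma> x y = conj_form ip C (T x) y))) \<and>
         (\<forall>T. T \<in> adjointable ip \<and> C_symmetric ip C T \<longrightarrow>
            (let \<Gamma>\<^sub>T = (\<lambda>x y. conj_form ip C (adjoint_op ip T x) y) in
               bounded_cbilinear \<Gamma>\<^sub>T \<and> symmetric_form sharp \<Gamma>\<^sub>T \<and>
               module_linear_fst act sharp \<Gamma>\<^sub>T \<and> module_linear_snd act \<Gamma>\<^sub>T))"
proof -
  interpret hilbert_module act ip
    by fact
  show ?thesis
    using symmetric_form_represented[OF assms(4,5)] C_symmetric_form[OF assms(2,5)]
    unfolding Let_def by blast
qed

end
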